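(* Let $q=p^m$, where $p$ is an odd prime and $m$ is a positive integer, let $\eta$ be the quadratic character of $\mathbb{F}_q$, let $w\in\mathbb{F}_q$ satisfy $\eta(w)=\eta(1+4w)=-1$, and write $\mathbb{F}_q=\{\alpha_1,\ldots,\alpha_{q-1},\alpha_q\}$ with $\alpha_q=0$. Let $\mathcal{C}_w$ be the ($[q+5,3,q+2]$ NMDS) linear code over $\mathbb{F}_q$ with generator matrix $$G_w=\begin{pmatrix} \alpha_1^2 & \alpha_2^2 & \cdots & \alpha_{q-1}^2 & \alpha_q^2 & 1 & 0 & 1 & 0 & w\\ \alpha_1 & \alpha_2 & \cdots & \alpha_{q-1} & \alpha_q & 0 & 1 & 1 & w & 0\\ 1 & 1 & \cdots & 1 & 1 & 0 & 0 & 0 & -1 & 1\end{pmatrix}.$$ Then $\mathcal{C}_w$ has locality $2$ and its dual code $\mathcal{C}_w^{\perp}$ has locality $q+1$. In addition, $\mathcal{C}_w$ (with $r=2$) and $\mathcal{C}_w^{\perp}$ (with $r=q+1$) are both $d$-optimal and $k$-optimal LRC codes.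
   Context: An $[n,k,d]$ linear code over $\mathbb{F}_q$ is a $k$-dimensional subspace $\mathcal{C}$ of $\mathbb{F}_q^n$ with minimum nonzero Hamming weight $d$. Its dual $\mathcal{C}^\perp$ is taken with respect to the Euclidean inner product. The Singleton defect of an $[n,k,d]$ code is $s(\mathcal{C})=n-k+1-d$; $\mathcal{C}$ is near maximum distance separable (NMDS) if $s(\mathcal{C})=s(\mathcal{C}^\perp)=1$. The quadratic character $\eta$ of $\mathbb{F}_q$ ($q$ odd) takes the value $1$ on nonzero squares, $-1$ on nonsquares, and $\eta(0)=0$. A code $\mathcal{C}$ of length $n$ has locality $r$ if for every $i\in[n]=\{1,\ldots,n\}$ there exist a subset $R_i\subseteq[n]\setminus\{i\}$ with $\#R_i\le r$ and a function $\phi_i$ such that $c_i=\phi_i(\{c_j : j\in R_i\})$ for every codeword $(c_1,\ldots,c_n)\in\mathcal{C}$. An $(n,k,r)$-LRC code (locally recoverable code) over $\mathbb{F}_q$ is a code of length $n$, cardinality $q^k$ and locality $r$. An $(n,k,r)$-LRC code with minimum distance $d$ is $d$-optimal if $d=n-k-\lceil k/r\rceil+2$. It is $k$-optimal if $$k=\min_{t\in\mathbb{Z}^{+}}\left[tr+k_{\mathrm{opt}}^{(q)}(n-t(r+1),d)\right],$$ where $\mathbb{Z}^+$ is the set of positive integers and $k_{\mathrm{opt}}^{(q)}(n',d)$ is the largest possible dimension ($\log_q$ of the cardinality) of a code of length $n'$ over an alphabet of size $q$ with minimum distance at least $d$ (a one-word code being allowed, of dimension $0$), with the convention $k_{\mathrm{opt}}^{(q)}(n',d)=0$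 for $n'\le 0$. *)

theory Defs
  imports Complex_Main "HOL-Library.Cardinality" "Jordan_Normal_Form.DL_Rank"
begin

text \<open>A code of length \<open>n\<close> is a set of vectors in \<open>carrier_vec n\<close>; its positions are numbered
  \<open>0, \<dots>, n - 1\<close>, as is usual for this vector type.\<close>

definition hamming_dist :: "'a vec \<Rightarrow> 'a vec \<Rightarrow> nat" where
  "hamming_dist x y = card {i. i < dim_vec x \<and> x $ i \<noteq> y $ i}"

definition hamming_weight :: "'a::zero vec \<Rightarrow> nat" where
  "hamming_weight x = card {i. i < dim_vec x \<and> x $ i \<noteq> 0}"

text \<open>A code with at most one word satisfies this condition for every \<open>d\<close>.\<close>

definition min_dist_ge :: "'a vec set \<Rightarrow> nat \<Rightarrow> bool" where
  "min_dist_ge C d \<longleftrightarrow> (\<forall>x\<in>C. \<forall>y\<in>C. x \<noteq> y \<longrightarrow> d \<le> hamming_dist x y)"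

definition has_min_dist :: "'a vec set \<Rightarrow> nat \<Rightarrow> bool" where
  "has_min_dist C d \<longleftrightarrow>
     (\<exists>x\<in>C. \<exists>y\<in>C. x \<noteq> y \<and> hamming_dist x y = d) \<and> min_dist_ge C d"

definition linear_code :: "nat \<Rightarrow> nat \<Rightarrow> nat \<Rightarrow> 'a::field vec set \<Rightarrow> bool" where
  "linear_code n k d C \<longleftrightarrow>
     VectorSpace.subspace class_ring C (module_vec TYPE('a) n) \<and>
     vectorspace.dim class_ring (module_vec TYPE('a) n\<lparr>carrier := C\<rparr>) = k \<and>
     (\<exists>c\<in>C. c \<noteq> 0\<^sub>v n \<and> hamming_weight c = d) \<and>
     (\<forall>c\<in>C. c \<noteq> 0\<^sub>v n \<longrightarrow> d \<le> hamming_weight c)"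

definition dual_code :: "nat \<Rightarrow> 'a::field vec set \<Rightarrow> 'a vec set" where
  "dual_code n C = {x \<in> carrier_vec n. \<forall>c\<in>C. x \<bullet> c = 0}"

definition singleton_defect :: "nat \<Rightarrow> nat \<Rightarrow> nat \<Rightarrow> int" where
  "singleton_defect n k d = int n - int k + 1 - int d"

definition NMDS :: "nat \<Rightarrow> 'a::field vec set \<Rightarrow> bool" where
  "NMDS n C \<longleftrightarrow>
     (\<exists>k d. linear_code n k d C \<and> singleton_defect n k d = 1) \<and>
     (\<exists>k d. linear_code n k d (dual_code n C) \<and> singleton_defect n k d = 1)"

definition quad_char :: "'a::field \<Rightarrow> int" where
  "quad_char x = (if x = 0 then 0 else if \<exists>y. x = y\<^sup>2 then 1 else - 1)"

text \<open>The recovery function \<open>\<phi>\<close> of position \<open>i\<close> is given the family \<open>(c\<^sub>j)\<close>, \<open>j \<in> R\<close>: by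
  \<^const>\<open>restrict\<close>, all entries of the codeword outside \<open>R\<close> are hidden from it.\<close>

definition has_locality :: "nat \<Rightarrow> nat \<Rightarrow> 'a vec set \<Rightarrow> bool" where
  "has_locality n r C \<longleftrightarrow>
     (\<forall>i<n. \<exists>R \<phi>. R \<subseteq> {..<n} - {i} \<and> card R \<le> r \<and>
        (\<forall>c\<in>C. c $ i = \<phi> (restrict (\<lambda>j. c $ j) R)))"

text \<open>The field is the type \<open>'a\<close>, so \<open>q = CARD('a)\<close>.\<close>

definition LRC :: "nat \<Rightarrow> nat \<Rightarrow> nat \<Rightarrow> 'a::{field,finite} vec set \<Rightarrow> bool" where
  "LRC n k r C \<longleftrightarrow>
     C \<subseteq> carrier_vec n \<and> card C = CARD('a) ^ k \<and> has_locality n r C"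

definition d_optimal :: "nat \<Rightarrow> nat \<Rightarrow> nat \<Rightarrow> 'a::{field,finite} vec set \<Rightarrow> bool" where
  "d_optimal n k r C \<longleftrightarrow> LRC n k r C \<and>
     (\<exists>d. has_min_dist C d \<and>
        int d = int n - int k - \<lceil>real k / real r\<rceil> + 2)"

text \<open>Arbitrary, possibly nonlinear, codes over the alphabet \<open>{0, \<dots>, q - 1}\<close> of size \<open>q\<close>. The
  length is an integer, since \<open>n - t(r + 1)\<close> below may be negative.\<close>

definition k_opt :: "nat \<Rightarrow> int \<Rightarrow> nat \<Rightarrow> real" where
  "k_opt q n d =
     (if n \<le> 0 then 0
      else Max {log (real q) (real (card C)) | C :: nat vec set.
        C \<noteq> {} \<and>
        C \<subseteq> {x \<in> carrier_vec (nat n). \<forall>i<nat n. x $ i < q} \<and>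
        min_dist_ge C d})"

definition k_optimal :: "nat \<Rightarrow> nat \<Rightarrow> nat \<Rightarrow> 'a::{field,finite} vec set \<Rightarrow> bool" where
  "k_optimal n k r C \<longleftrightarrow> LRC n k r C \<and>
     (\<exists>d. has_min_dist C d \<and>
        (let f = (\<lambda>t::nat. real (t * r) + k_opt CARD('a) (int n - int (t * (r + 1))) d)
         in (\<exists>t\<ge>1. real k = f t) \<and> (\<forall>t\<ge>1. real k \<le> f t)))"

definition gen_mat :: "nat \<Rightarrow> (nat \<Rightarrow> 'a::field) \<Rightarrow> 'a \<Rightarrow> 'a mat" where
  "gen_mat q \<alpha> w = mat_of_rows_list (q + 5)
     [map (\<lambda>j. (\<alpha> j)\<^sup>2) [1..<q + 1] @ [1, 0, 1, 0, w],
      map \<alpha> [1..<q + 1]         @ [0, 1, 1, w, 0],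
      replicate q 1            @ [0, 0, 0, - 1, 1]]"

definition code_w :: "nat \<Rightarrow> (nat \<Rightarrow> 'a::field) \<Rightarrow> 'a \<Rightarrow> 'a vec set" where
  "code_w q \<alpha> w = vec_space.row_space (q + 5) (gen_mat q \<alpha> w)"

end

(* The columns of the generator matrix are the conic points (x^2, x, 1) and (1, 0, 0), together
   with four further points of the projective plane. Every line contains at most three of them, so
   nonzero codewords have weight at least q + 2; distinct columns are independent, so nonzero dual
   words have weight at least 3. Every column lies on a line through three of them, which yields a
   dual word of weight 3 through every position and hence locality 2. Conversely, three such lines
   without a common column give codewords of weight q + 2 covering all positions, hence locality
   q + 1 of the dual. In both cases k = r + 1 and n = d + k, so the term t = 1 of the bound is
   r + k_opt(d, d) = r + 1, while later terms are at least 2 r. *)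
theory Submission
  imports Defs "HOL-Library.Product_Plus"
begin

section \<open>Vectors and vector spaces over finite sets of scalars\<close>

lemma bij_betw_vec_entries:
  "bij_betw (\<lambda>x. restrict (vec_index x) {..<n})
     {x \<in> carrier_vec n. \<forall>i<n. x $ i \<in> A} ({..<n} \<rightarrow>\<^sub>E A)"
  by (rule bij_betw_byWitness[where f' = "vec n"])
     (auto simp: PiE_def extensional_def fun_eq_iff)

lemma finite_vec_entries:
  "finite A \<Longrightarrow> finite {x \<in> carrier_vec n. \<forall>i<n. x $ i \<in> A}"
  by (subst bij_betw_finite[OF bij_betw_vec_entries]) (simp add: finite_PiE)

lemma card_vec_entries:
  "card {x \<in> carrier_vec n. \<forall>i<n. x $ i \<in> A} = card A ^ n"
  using bij_betw_same_card[OF bij_betw_vec_entries] by (simp add: card_PiE)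

lemma card_carrier_vec: "card (carrier_vec n :: 'a::finite vec set) = CARD('a) ^ n"
  using card_vec_entries[of n "UNIV :: 'a set"] by simp

lemma finite_carrier_vec: "finite (carrier_vec n :: 'a::finite vec set)"
  using finite_vec_entries[of "UNIV :: 'a set" n] by simp

text \<open>Finiteness makes the whole carrier a finite spanning set, so the space is
  finite-dimensional; coordinates in a finite basis then identify vectors with functions from the
  basis to the scalars.\<close>

lemma (in vectorspace) card_carrier_eq_power_dim:
  assumes fV: "finite (carrier V)"
  shows "card (carrier V) = card (carrier K) ^ dim"
proof -
  have "fin_dim" unfolding fin_dim_def
    using fV span_is_subset2[of "carrier V"] in_own_span[of "carrier V"] by blast
  then obtain B where B: "finite B" "basis B" using finite_basis_exists by blast
  then have BV: "B \<subseteq> carrier V" by (simp add: basis_def)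
  have "\<forall>v. v \<in> carrier V \<longrightarrow> (\<exists>!a. a \<in> B \<rightarrow>\<^sub>E carrier K \<and> lincomb a B = v)"
    using basis_criterion[OF B(1) BV] B(2) by blast
  then have "bij_betw (\<lambda>a. lincomb a B) (B \<rightarrow>\<^sub>E carrier K) (carrier V)"
    using lincomb_closed[OF BV] unfolding bij_betw_def inj_on_def
    by (auto simp: image_iff PiE_def; metis)
  then have "card (carrier V) = card (B \<rightarrow>\<^sub>E carrier K)"
    by (rule bij_betw_same_card[symmetric])
  then show ?thesis using B by (simp add: card_PiE dim_basis)
qed

lemma subspace_vecI:
  fixes C :: "'a::field vec set"
  assumes "C \<subseteq> carrier_vec n" and "0\<^sub>v n \<in> C"
    and "\<And>x y. x \<in> C \<Longrightarrow> y \<in> C \<Longrightarrow> x + y \<in> C"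
    and "\<And>s x. x \<in> C \<Longrightarrow> s \<cdot>\<^sub>v x \<in> C"
  shows "VectorSpace.subspace class_ring C (module_vec TYPE('a) n)"
  using assms vec_vs[where ?'a = 'a] vec_module[where ?'a = 'a]
  unfolding VectorSpace.subspace_def submodule_def
  by (auto simp: module_vec_simps class_ring_simps)

lemma scalar_prod_two_entries:
  fixes x y :: "'a::comm_ring_1 vec"
  assumes "x \<in> carrier_vec n" "y \<in> carrier_vec n" "{l. l < n \<and> x $ l \<noteq> 0} \<subseteq> {i, j}"
    "i < n" "j < n" "i \<noteq> j"
  shows "x \<bullet> y = x $ i * y $ i + x $ j * y $ j"
proof -
  have "x \<bullet> y = (\<Sum>l<n. x $ l * y $ l)"
    using assms by (simp add: scalar_prod_def atLeast0LessThan)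
  also have "\<dots> = (\<Sum>l\<in>{i, j}. x $ l * y $ l)"
    using assms by (intro sum.mono_neutral_right) auto
  finally show ?thesis using assms by simp
qed

lemma card_quadratic_roots_le:
  fixes a b c :: "'a::idom"
  assumes "a \<noteq> 0"
  shows "card {x. a * x\<^sup>2 + b * x + c = 0} \<le> 2"
  using card_poly_roots_bound[of "[:c, b, a:]"] assms
  by (simp add: algebra_simps power2_eq_square)

section \<open>Linear codes\<close>

text \<open>Reads the dimension off the cardinality, since powers of a base above 1 determine the
  exponent; this avoids exhibiting a basis of the code.\<close>

lemma linear_codeI:
  fixes C :: "'a::{field,finite} vec set"
  assumes sub: "VectorSpace.subspace class_ring C (module_vec TYPE('a) n)"
    and card: "card C = CARD('a) ^ k"
    and "\<exists>c\<in>C. c \<noteq> 0\<^sub>v n \<and> hamming_weight c = d"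
    and "\<And>c. c \<in> C \<Longrightarrow> c \<noteq> 0\<^sub>v n \<Longrightarrow> d \<le> hamming_weight c"
  shows "linear_code n k d C"
proof -
  interpret V: vectorspace class_ring "module_vec TYPE('a) n" by (rule vec_vs)
  interpret W: vectorspace class_ring "module_vec TYPE('a) n\<lparr>carrier := C\<rparr>"
    using V.subspace_is_vs[OF sub] .
  have "C \<subseteq> carrier_vec n"
    using sub by (auto simp: VectorSpace.subspace_def submodule_def module_vec_simps)
  then have "finite C" using finite_carrier_vec finite_subset by blast
  then have "CARD('a) ^ W.dim = CARD('a) ^ k"
    using W.card_carrier_eq_power_dim card by (simp add: class_ring_simps)
  moreover have "CARD('a) > 1"
    using card_mono[of "UNIV :: 'a set" "{0, 1}"] by simp
  ultimately have "W.dim = k" by simp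
  then show ?thesis using assms by (simp add: linear_code_def)
qed

lemma hamming_dist_eq_weight:
  fixes x y :: "'a::ring_1 vec"
  assumes "x \<in> carrier_vec n" "y \<in> carrier_vec n"
  shows "hamming_dist x y = hamming_weight (x - y)"
proof -
  have "{i. i < dim_vec x \<and> x $ i \<noteq> y $ i} = {i. i < dim_vec (x - y) \<and> (x - y) $ i \<noteq> 0}"
    using assms by auto
  then show ?thesis by (simp add: hamming_dist_def hamming_weight_def)
qed

text \<open>Distances are weights of differences, which stay in the code by linearity; a word of
  minimum weight attains the distance to the zero word.\<close>

lemma linear_code_has_min_dist:
  fixes C :: "'a::field vec set"
  assumes "linear_code n k d C"
  shows "has_min_dist C d"
proof -
  have sub: "submodule class_ring C (module_vec TYPE('a) n)"
    using assms by (simp add: linear_code_def VectorSpace.subspace_def)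
  have C: "C \<subseteq> carrier_vec n" "0\<^sub>v n \<in> C" "\<And>x y. x \<in> C \<Longrightarrow> y \<in> C \<Longrightarrow> x + y \<in> C"
    "\<And>s x. x \<in> C \<Longrightarrow> s \<cdot>\<^sub>v x \<in> C"
    using sub by (auto simp: submodule_def module_vec_simps class_ring_simps)
  have diff: "x - y \<in> C" if "x \<in> C" "y \<in> C" for x y
  proof -
    have "x - y = x + (- 1) \<cdot>\<^sub>v y" using that C(1) by (intro eq_vecI) auto
    then show ?thesis using that C by metis
  qed
  have nz: "x - y \<noteq> 0\<^sub>v n" if "x \<in> C" "y \<in> C" "x \<noteq> y" for x y
  proof
    assume *: "x - y = 0\<^sub>v n"
    have "x = y"
    proof (rule eq_vecI)
      show "dim_vec x = dim_vec y" using that C(1) by (metis carrier_vecD subsetD)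
      fix i assume "i < dim_vec y"
      then show "x $ i = y $ i" using * that C(1)
        by (metis carrier_vecD index_minus_vec(1) index_zero_vec(1) right_minus_eq subsetD)
    qed
    then show False using that by simp
  qed
  have ge: "min_dist_ge C d" unfolding min_dist_ge_def
  proof (intro ballI impI)
    fix x y assume xy: "x \<in> C" "y \<in> C" "x \<noteq> y"
    then have "hamming_dist x y = hamming_weight (x - y)"
      using C(1) hamming_dist_eq_weight by blast
    then show "d \<le> hamming_dist x y"
      using diff nz xy assms by (auto simp: linear_code_def)
  qed
  obtain c where c: "c \<in> C" "c \<noteq> 0\<^sub>v n" "hamming_weight c = d"
    using assms by (auto simp: linear_code_def)
  then have "c - 0\<^sub>v n = c" using C(1) by auto
  then have "hamming_dist c (0\<^sub>v n) = d"
    using c C(1) hamming_dist_eq_weight[of c n "0\<^sub>v n"] by auto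
  then show ?thesis using ge c C(2) by (auto simp: has_min_dist_def)
qed

lemma subspace_dual_code:
  fixes C :: "'a::field vec set"
  assumes "C \<subseteq> carrier_vec n"
  shows "VectorSpace.subspace class_ring (dual_code n C) (module_vec TYPE('a) n)"
proof (rule subspace_vecI)
  fix x y assume "x \<in> dual_code n C" "y \<in> dual_code n C"
  then show "x + y \<in> dual_code n C"
    using assms by (auto simp: dual_code_def add_scalar_prod_distrib[where n = n] subset_iff)
next
  fix s x assume "x \<in> dual_code n C"
  then show "s \<cdot>\<^sub>v x \<in> dual_code n C"
    using assms by (auto simp: dual_code_def subset_iff)
qed (use assms in \<open>auto simp: dual_code_def\<close>)

text \<open>A check equation that is nonzero at \<open>i\<close> can be solved for the entry there;
  the rest of its support, at most \<open>r\<close> positions, is the recovery set.\<close>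

lemma has_locality_if_check_words:
  fixes C :: "'a::field vec set"
  assumes C: "C \<subseteq> carrier_vec n"
    and chk: "\<And>i. i < n \<Longrightarrow> \<exists>x\<in>carrier_vec n.
      (\<forall>c\<in>C. x \<bullet> c = 0) \<and> x $ i \<noteq> 0 \<and> hamming_weight x \<le> r + 1"
  shows "has_locality n r C"
  unfolding has_locality_def
proof (intro allI impI)
  fix i assume i: "i < n"
  from chk[OF i] obtain x where x: "x \<in> carrier_vec n" "\<forall>c\<in>C. x \<bullet> c = 0" "x $ i \<noteq> 0"
    "hamming_weight x \<le> r + 1" by blast
  define S where "S = {j. j < n \<and> x $ j \<noteq> 0}"
  define R where "R = S - {i}"
  \<comment> \<open>Reads its argument only on \<open>R\<close>, so \<open>restrict\<close> does not
    affect the value.\<close>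
  define \<phi> where "\<phi> f = - (\<Sum>j\<in>R. x $ j * f j) / x $ i" for f
  have S: "finite S" "i \<in> S" "S \<subseteq> {..<n}" using i x by (auto simp: S_def)
  have "R \<subseteq> {..<n} - {i}" by (auto simp: R_def S_def)
  moreover have "card R \<le> r"
    using x(1,4) S by (simp add: R_def hamming_weight_def S_def)
  moreover have "c $ i = \<phi> (restrict (\<lambda>j. c $ j) R)" if "c \<in> C" for c
  proof -
    have "0 = (\<Sum>j<n. x $ j * c $ j)"
      using x(2) that C by (force simp: scalar_prod_def atLeast0LessThan)
    also have "\<dots> = (\<Sum>j\<in>S. x $ j * c $ j)"
      using S by (intro sum.mono_neutral_right) (auto simp: S_def)
    also have "\<dots> = x $ i * c $ i + (\<Sum>j\<in>R. x $ j * c $ j)"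
      unfolding R_def using S by (simp add: sum.remove)
    finally have "x $ i * c $ i = - (\<Sum>j\<in>R. x $ j * c $ j)"
      by (simp add: eq_neg_iff_add_eq_0)
    then have "c $ i = - (\<Sum>j\<in>R. x $ j * c $ j) / x $ i"
      using x(3) by (simp add: field_simps)
    then show ?thesis by (simp add: \<phi>_def)
  qed
  ultimately show "\<exists>R \<phi>. R \<subseteq> {..<n} - {i} \<and> card R \<le> r \<and>
      (\<forall>c\<in>C. c $ i = \<phi> (restrict (\<lambda>j. c $ j) R))"
    by blast
qed

section \<open>The largest dimension of a code\<close>

text \<open>Makes \<open>Max\<close> in \<open>k_opt\<close> meaningful: over a finite alphabet
  there are finitely many codes of a given length.\<close>

lemma finite_k_opt_set:
  "finite {log (real q) (real (card C)) | C :: nat vec set.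
     C \<noteq> {} \<and> C \<subseteq> {x \<in> carrier_vec n. \<forall>i<n. x $ i < q} \<and> min_dist_ge C d}"
proof -
  have "finite {x :: nat vec \<in> carrier_vec n. \<forall>i<n. x $ i < q}"
    using finite_vec_entries[of "{..<q}" n] by simp
  then have "finite (Pow {x :: nat vec \<in> carrier_vec n. \<forall>i<n. x $ i < q})" by simp
  then have "finite ((\<lambda>C. log (real q) (real (card C))) `
      Pow {x :: nat vec \<in> carrier_vec n. \<forall>i<n. x $ i < q})" by (rule finite_imageI)
  then show ?thesis by (rule rev_finite_subset) auto
qed

lemma k_opt_ge:
  assumes "C \<noteq> {}" "C \<subseteq> {x :: nat vec \<in> carrier_vec (nat n). \<forall>i<nat n. x $ i < q}"
    "min_dist_ge C d" "n > 0"
  shows "log (real q) (real (card C)) \<le> k_opt q n d"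
  unfolding k_opt_def using assms
  by (auto intro!: Max_ge finite_k_opt_set)

text \<open>For positive length the one-word code already has dimension log 1 = 0; otherwise the
  convention applies.\<close>

lemma k_opt_nonneg:
  assumes "q > 0"
  shows "k_opt q n d \<ge> 0"
proof (cases "n > 0")
  case True
  have "log (real q) (real (card {0\<^sub>v (nat n) :: nat vec})) \<le> k_opt q n d"
    by (rule k_opt_ge) (use True assms in \<open>auto simp: min_dist_ge_def\<close>)
  then show ?thesis by simp
qed (simp add: k_opt_def)

text \<open>If the distance equals the length, distinct words differ everywhere, so one entry
  determines the word and there are at most \<open>q\<close> words; the repetition code attains
  this.\<close>

lemma k_opt_self:
  assumes q: "q \<ge> 2" and n: "n > 0"
  shows "k_opt q (int n) n = 1"
proof (rule antisym)
  let ?A = "{x :: nat vec \<in> carrier_vec n. \<forall>i<n. x $ i < q}"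
  let ?S = "{log (real q) (real (card C)) | C :: nat vec set.
     C \<noteq> {} \<and> C \<subseteq> ?A \<and> min_dist_ge C n}"
  have "log (real q) (real (card C)) \<le> 1" if C: "C \<noteq> {}" "C \<subseteq> ?A" "min_dist_ge C n" for C
  proof -
    have "inj_on (\<lambda>x. x $ 0) C"
    proof (rule inj_onI, rule ccontr)
      fix x y assume xy: "x \<in> C" "y \<in> C" "x $ 0 = y $ 0" "x \<noteq> y"
      then have "hamming_dist x y \<le> card {1..<n}"
        unfolding hamming_dist_def using C(2)
        by (intro card_mono subsetI) (auto simp: Suc_le_eq intro!: gr0I dest!: subsetD)
      then show False using xy C(3) n by (fastforce simp: min_dist_ge_def)
    qed
    moreover have "(\<lambda>x. x $ 0) ` C \<subseteq> {..<q}" using C(2) n by auto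
    ultimately have "card C \<le> q" using card_inj_on_le[of "\<lambda>x. x $ 0" C "{..<q}"] by simp
    moreover have "finite C"
      using C(2) finite_vec_entries[of "{..<q}" n] by (auto intro: finite_subset)
    then have "card C > 0" using C(1) by (simp add: card_gt_0_iff)
    ultimately have "log (real q) (real (card C)) \<le> log (real q) (real q)"
      using q by (subst log_le_cancel_iff) auto
    then show ?thesis using q by simp
  qed
  \<comment> \<open>The one-word code as a member, because \<open>Max_le_iff\<close> requires a
    nonempty set.\<close>
  moreover have "log (real q) (real (card {0\<^sub>v n :: nat vec})) \<in> ?S"
    using q by (intro CollectI exI[of _ "{0\<^sub>v n}"]) (auto simp: min_dist_ge_def)
  then have "?S \<noteq> {}" by blast
  ultimately have "Max ?S \<le> 1"
    by (subst Max_le_iff) (auto simp: finite_k_opt_set)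
  then show "k_opt q (int n) n \<le> 1" using n by (simp add: k_opt_def)
next
  let ?rep = "\<lambda>a::nat. vec n (\<lambda>_. a)"
  have inj: "inj_on ?rep {..<q}"
    using n by (auto simp: inj_on_def vec_eq_iff)
  have "min_dist_ge (?rep ` {..<q}) n"
    unfolding min_dist_ge_def hamming_dist_def
  proof (intro ballI impI)
    fix x y assume "x \<in> ?rep ` {..<q}" "y \<in> ?rep ` {..<q}" "x \<noteq> y"
    then have "{i. i < dim_vec x \<and> x $ i \<noteq> y $ i} = {..<n}" by auto
    then show "n \<le> card {i. i < dim_vec x \<and> x $ i \<noteq> y $ i}" by simp
  qed
  then have "log (real q) (real (card (?rep ` {..<q}))) \<le> k_opt q (int n) n"
    using q n by (intro k_opt_ge) (auto simp: lessThan_empty_iff bot_nat_def)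
  then show "1 \<le> k_opt q (int n) n"
    using q by (simp add: card_image[OF inj])
qed

lemma k_optimalI:
  fixes C :: "'a::{field,finite} vec set"
  assumes "LRC n k r C" "has_min_dist C d" "k = r + 1" "n = d + k" "d > 0" "r > 0"
  shows "k_optimal n k r C"
proof -
  have q: "CARD('a) \<ge> 2"
    using card_mono[of "UNIV :: 'a set" "{0, 1}"] by simp
  define f where "f = (\<lambda>t::nat. real (t * r) + k_opt CARD('a) (int n - int (t * (r + 1))) d)"
  \<comment> \<open>The length left is \<open>n - (r + 1) = d\<close>, the case of
    \<open>k_opt_self\<close>.\<close>
  have "f 1 = real (r + 1)"
    using assms k_opt_self[OF q, of d] by (simp add: f_def algebra_simps)
  moreover have "real (r + 1) \<le> f t" if "t > 1" for t
  proof -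
    \<comment> \<open>From \<open>t \<ge> 2\<close> and \<open>r \<ge> 1\<close>. The length left
      may be negative here, so \<open>k_opt\<close> is only bounded below by 0.\<close>
    have "r + 1 \<le> t * r" using that assms(6) mult_le_mono1[of 2 t r] by linarith
    moreover have "k_opt CARD('a) (int n - int (t * (r + 1))) d \<ge> 0"
      using q by (intro k_opt_nonneg) auto
    ultimately show ?thesis by (simp only: f_def)
  qed
  ultimately have "(\<exists>t\<ge>1. real (r + 1) = f t) \<and> (\<forall>t\<ge>1. real (r + 1) \<le> f t)"
    by (metis le_eq_less_or_eq order_refl)
  then show ?thesis
    unfolding k_optimal_def using assms by (auto simp: f_def Let_def)
qed

section \<open>The code and its dual\<close>

text \<open>The value - 1 of the quadratic character is expressed as having no square root; since
  \<open>y\<close> may be 0, this also makes \<open>w\<close> and \<open>1 + 4 * w\<close>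
  nonzero.\<close>

locale nmds_parameters =
  fixes q :: nat and \<alpha> :: "nat \<Rightarrow> 'a::{field,finite}" and w :: 'a
  assumes card_field: "CARD('a) = q"
    and nonsquare: "y\<^sup>2 \<noteq> w"
    and nonsquare_disc: "y\<^sup>2 \<noteq> 1 + 4 * w"
    and bij_\<alpha>: "bij_betw \<alpha> {1..q} UNIV"
    and \<alpha>_q: "\<alpha> q = 0"
begin

section \<open>Consequences of the nonsquare conditions, and the enumeration of the field\<close>

lemma w_nz: "w \<noteq> 0"
  using nonsquare[of 0] by auto

text \<open>In characteristic 2, \<open>1 + 4 * w\<close> would be 1, a square.\<close>

lemma two_nz: "(2::'a) \<noteq> 0"
proof
  assume "(2::'a) = 0"
  moreover have "(4::'a) = 2 * 2" by simp
  ultimately have "(4::'a) = 0" by (simp only: mult_zero_left)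
  then show False using nonsquare_disc[of 1] by simp
qed

lemma q_gt_1: "q > 1"
  using card_mono[of "UNIV :: 'a set" "{0, 1}"] card_field by simp

text \<open>Vector positions start at 0 but the enumeration at 1, so position \<open>j < q\<close>
  carries \<open>\<alpha> (Suc j)\<close>.\<close>

lemma bij_\<alpha>': "bij_betw (\<lambda>j. \<alpha> (Suc j)) {..<q} UNIV"
proof -
  have "bij_betw Suc {..<q} {1..q}"
    by (rule bij_betw_byWitness[where f' = "\<lambda>j. j - 1"]) auto
  then show ?thesis using bij_betw_trans[OF _ bij_\<alpha>, of Suc] by (simp add: o_def)
qed

lemma \<alpha>_surj: obtains j where "j < q" "\<alpha> (Suc j) = x"
  using bij_betw_imp_surj_on[OF bij_\<alpha>'] by (metis UNIV_I imageE lessThan_iff)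

lemma \<alpha>_eq_iff: "i < q \<Longrightarrow> j < q \<Longrightarrow> \<alpha> (Suc i) = \<alpha> (Suc j) \<longleftrightarrow> i = j"
  using bij_betw_imp_inj_on[OF bij_\<alpha>'] by (auto simp: inj_on_def)

section \<open>Codewords as values of linear forms\<close>

text \<open>The entries are the values of the form a x + b y + c z at the columns (x, y, z) of the
  generator matrix, so the zeros of a nonzero word are the columns on a line.\<close>

definition word :: "'a \<Rightarrow> 'a \<Rightarrow> 'a \<Rightarrow> 'a vec" where
  "word a b c = vec (q + 5) (\<lambda>j.
     if j < q then a * (\<alpha> (Suc j))\<^sup>2 + b * \<alpha> (Suc j) + c
     else [a, b, a + b, b * w - c, a * w + c] ! (j - q))"

lemma word_carrier [simp]: "word a b c \<in> carrier_vec (q + 5)"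
  by (simp add: word_def)

lemma dim_word [simp]: "dim_vec (word a b c) = q + 5"
  by (simp add: word_def)

lemma word_nth [simp]:
  "j < q \<Longrightarrow> word a b c $ j = a * (\<alpha> (Suc j))\<^sup>2 + b * \<alpha> (Suc j) + c"
  "word a b c $ q = a" "word a b c $ Suc q = b" "word a b c $ Suc (Suc q) = a + b"
  "word a b c $ (q + 3) = b * w - c" "word a b c $ (q + 4) = a * w + c"
  by (auto simp: word_def)

text \<open>Position \<open>q - 1\<close> carries \<open>\<alpha> q = 0\<close>, so its column is
  the unit vector (0, 0, 1).\<close>

lemma word_nth_last [simp]: "word a b c $ (q - Suc 0) = c"
  using q_gt_1 \<alpha>_q by simp

lemma position_cases:
  assumes "j < q + 5"
  obtains "j < q" | "j = q" | "j = Suc q" | "j = Suc (Suc q)" | "j = q + 3" | "j = q + 4"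
  using assms by linarith

text \<open>The three words on the right are the rows of the generator matrix; linear statements
  about codewords reduce to them.\<close>

lemma word_linear:
  "word a b c = a \<cdot>\<^sub>v word 1 0 0 + b \<cdot>\<^sub>v word 0 1 0 + c \<cdot>\<^sub>v word 0 0 1"
proof (rule eq_vecI)
  fix j assume "j < dim_vec (a \<cdot>\<^sub>v word 1 0 0 + b \<cdot>\<^sub>v word 0 1 0 + c \<cdot>\<^sub>v word 0 0 1)"
  then have "j < q + 5" by simp
  then show "word a b c $ j = (a \<cdot>\<^sub>v word 1 0 0 + b \<cdot>\<^sub>v word 0 1 0 + c \<cdot>\<^sub>v word 0 0 1) $ j"
    by (cases rule: position_cases) (simp_all add: algebra_simps)
qed simp

lemma word_inj: "word a b c = word a' b' c' \<longleftrightarrow> a = a' \<and> b = b' \<and> c = c'"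
  by (metis word_nth(2,3) word_nth_last)

lemma word_eq_0: "word a b c = 0\<^sub>v (q + 5) \<longleftrightarrow> a = 0 \<and> b = 0 \<and> c = 0"
proof -
  have "word 0 0 0 = 0\<^sub>v (q + 5)" by (subst word_linear) (auto intro!: eq_vecI)
  then show ?thesis using word_inj[of a b c 0 0 0] by simp
qed

section \<open>The generator matrix and its row space\<close>

lemma gen_mat_carrier: "gen_mat q \<alpha> w \<in> carrier_mat 3 (q + 5)"
  unfolding gen_mat_def mat_of_rows_list_def
  by (rule carrier_matI) (simp_all only: dim_row_mat dim_col_mat list.size)

lemma gen_mat_nth:
  assumes j: "j < q + 5"
  shows "gen_mat q \<alpha> w $$ (0, j) = word 1 0 0 $ j"
    and "gen_mat q \<alpha> w $$ (1, j) = word 0 1 0 $ j"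
    and "gen_mat q \<alpha> w $$ (2, j) = word 0 0 1 $ j"
proof -
  let ?R = "[map (\<lambda>j. (\<alpha> j)\<^sup>2) [1..<q + 1] @ [1, 0, 1, 0, w],
      map \<alpha> [1..<q + 1] @ [0, 1, 1, w, 0], replicate q 1 @ [0, 0, 0, - 1, 1]]"
  have upt: "length [1..<q + 1] = q" "i < q \<Longrightarrow> [1..<q + 1] ! i = Suc i" for i
    by (simp_all del: upt_Suc)
  have "gen_mat q \<alpha> w $$ (i, j) = ?R ! i ! j" if "i < 3" for i
    using that j unfolding gen_mat_def mat_of_rows_list_def by (subst index_mat(1)) auto
  from this[of 0] this[of 1] this[of 2]
  have rows: "gen_mat q \<alpha> w $$ (0, j) = (map (\<lambda>j. (\<alpha> j)\<^sup>2) [1..<q + 1] @ [1, 0, 1, 0, w]) ! j"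
    "gen_mat q \<alpha> w $$ (1, j) = (map \<alpha> [1..<q + 1] @ [0, 1, 1, w, 0]) ! j"
    "gen_mat q \<alpha> w $$ (2, j) = (replicate q 1 @ [0, 0, 0, - 1, 1]) ! j"
    by (simp_all del: upt_Suc)
  show "gen_mat q \<alpha> w $$ (0, j) = word 1 0 0 $ j"
    unfolding rows(1) using j
    by (cases rule: position_cases) (simp_all add: nth_append upt del: upt_Suc)
  show "gen_mat q \<alpha> w $$ (1, j) = word 0 1 0 $ j"
    unfolding rows(2) using j
    by (cases rule: position_cases) (simp_all add: nth_append upt del: upt_Suc)
  show "gen_mat q \<alpha> w $$ (2, j) = word 0 0 1 $ j"
    unfolding rows(3) using j
    by (cases rule: position_cases) (simp_all add: nth_append upt del: upt_Suc)
qed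

lemma gen_mat_transpose_mult:
  assumes y: "y \<in> carrier_vec 3"
  shows "(gen_mat q \<alpha> w)\<^sup>T *\<^sub>v y = word (y $ 0) (y $ 1) (y $ 2)"
proof (rule eq_vecI)
  fix j assume "j < dim_vec (word (y $ 0) (y $ 1) (y $ 2))"
  then have j: "j < q + 5" by simp
  have "((gen_mat q \<alpha> w)\<^sup>T *\<^sub>v y) $ j = col (gen_mat q \<alpha> w) j \<bullet> y"
    using gen_mat_carrier j by simp
  also have "\<dots> = (\<Sum>i<3. gen_mat q \<alpha> w $$ (i, j) * y $ i)"
    using gen_mat_carrier j y unfolding scalar_prod_def atLeast0LessThan by (intro sum.cong) auto
  also have "\<dots> = y $ 0 * word 1 0 0 $ j + y $ 1 * word 0 1 0 $ j + y $ 2 * word 0 0 1 $ j"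
    using gen_mat_nth[OF j] by (simp add: numeral_3_eq_3 numeral_2_eq_2 mult.commute)
  also have "\<dots> = word (y $ 0) (y $ 1) (y $ 2) $ j"
    \<comment> \<open>The fourth occurrence of \<open>word\<close> is the right-hand side; the first
      three are rows already.\<close>
    by (subst (4) word_linear) (use j in simp)
  finally show "((gen_mat q \<alpha> w)\<^sup>T *\<^sub>v y) $ j = word (y $ 0) (y $ 1) (y $ 2) $ j" .
qed (use gen_mat_carrier in simp)

text \<open>The row space is the image of the transposed matrix, which sends a message (a, b, c) to
  its \<open>word\<close>.\<close>

lemma code_w_eq: "code_w q \<alpha> w = range (\<lambda>(a, b, c). word a b c)"
proof (intro equalityI subsetI)
  fix v assume "v \<in> code_w q \<alpha> w"
  then obtain y where "y \<in> carrier_vec 3" "v = (gen_mat q \<alpha> w)\<^sup>T *\<^sub>v y"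
    using vec_space.row_space_eq[OF gen_mat_carrier] gen_mat_carrier
    unfolding code_w_def by force
  then have "v = (\<lambda>(a, b, c). word a b c) (y $ 0, y $ 1, y $ 2)"
    using gen_mat_transpose_mult by simp
  then show "v \<in> range (\<lambda>(a, b, c). word a b c)" by blast
next
  fix v assume "v \<in> range (\<lambda>(a, b, c). word a b c)"
  then obtain a b c where v: "v = word a b c" by auto
  have y: "vec_of_list [a, b, c] \<in> carrier_vec 3"
    by (rule carrier_vecI) simp
  have "(gen_mat q \<alpha> w)\<^sup>T *\<^sub>v vec_of_list [a, b, c] = v"
    unfolding v gen_mat_transpose_mult[OF y] by (simp add: numeral_2_eq_2)
  moreover have "v \<in> carrier_vec (q + 5)" by (simp add: v)
  ultimately show "v \<in> code_w q \<alpha> w"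
    using vec_space.row_space_eq[OF gen_mat_carrier] gen_mat_carrier y
    unfolding code_w_def by auto
qed

lemma word_in_code_w: "word a b c \<in> code_w q \<alpha> w"
  unfolding code_w_eq by (rule image_eqI[of _ _ "(a, b, c)"]) auto

lemma code_w_carrier: "code_w q \<alpha> w \<subseteq> carrier_vec (q + 5)"
  by (auto simp: code_w_eq)

lemma subspace_code_w:
  "VectorSpace.subspace class_ring (code_w q \<alpha> w) (module_vec TYPE('a) (q + 5))"
proof (rule subspace_vecI)
  show "0\<^sub>v (q + 5) \<in> code_w q \<alpha> w"
    using word_eq_0[of 0 0 0] word_in_code_w by metis
  have add: "word a b c + word a' b' c' = word (a + a') (b + b') (c + c')" for a b c a' b' c'
  proof (rule eq_vecI)
    fix j assume "j < dim_vec (word (a + a') (b + b') (c + c'))"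
    then have "j < q + 5" by simp
    then show "(word a b c + word a' b' c') $ j = word (a + a') (b + b') (c + c') $ j"
      by (cases rule: position_cases) (simp_all add: algebra_simps)
  qed simp
  have smult: "s \<cdot>\<^sub>v word a b c = word (s * a) (s * b) (s * c)" for s a b c
  proof (rule eq_vecI)
    fix j assume "j < dim_vec (word (s * a) (s * b) (s * c))"
    then have "j < q + 5" by simp
    then show "(s \<cdot>\<^sub>v word a b c) $ j = word (s * a) (s * b) (s * c) $ j"
      by (cases rule: position_cases) (simp_all add: algebra_simps)
  qed simp
  show "x + y \<in> code_w q \<alpha> w" if "x \<in> code_w q \<alpha> w" "y \<in> code_w q \<alpha> w" for x y
    using that word_in_code_w by (auto simp: code_w_eq add)
  show "s \<cdot>\<^sub>v x \<in> code_w q \<alpha> w" if "x \<in> code_w q \<alpha> w" for s x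
    using that word_in_code_w by (auto simp: code_w_eq smult)
qed (rule code_w_carrier)

lemma card_code_w: "card (code_w q \<alpha> w) = CARD('a) ^ 3"
proof -
  have "inj (\<lambda>(a, b, c). word a b c)" by (auto simp: inj_def word_inj)
  then have "card (code_w q \<alpha> w) = CARD('a \<times> 'a \<times> 'a)"
    unfolding code_w_eq by (rule card_image)
  then show ?thesis by (simp add: card_prod power3_eq_cube)
qed

section \<open>Weights of codewords\<close>

text \<open>Counts the zero entries: roots of the polynomial on the conic columns, one indicator for
  each of the last five. The additive form avoids truncated subtraction.\<close>

lemma hamming_weight_word:
  "hamming_weight (word a b c) + (card {x. a * x\<^sup>2 + b * x + c = 0} + of_bool (a = 0)
     + of_bool (b = 0) + of_bool (a + b = 0) + of_bool (b * w - c = 0) + of_bool (a * w + c = 0))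
   = q + 5"
proof -
  let ?Z = "\<lambda>j. of_bool (word a b c $ j = 0) :: nat"
  have "(\<Sum>j<q. ?Z j) = (\<Sum>j<q. of_bool (a * (\<alpha> (Suc j))\<^sup>2 + b * \<alpha> (Suc j) + c = 0))"
    by (intro sum.cong) auto
  also have "\<dots> = (\<Sum>x\<in>UNIV. of_bool (a * x\<^sup>2 + b * x + c = 0))"
    by (rule sum.reindex_bij_betw[OF bij_\<alpha>'])
  also have "\<dots> = card {x. a * x\<^sup>2 + b * x + c = 0}" by simp
  finally have "card {x. a * x\<^sup>2 + b * x + c = 0} + ?Z q + ?Z (Suc q) + ?Z (Suc (Suc q)) + ?Z (q + 3)
      + ?Z (q + 4) = (\<Sum>j<q + 5. ?Z j)"
    by (simp add: numeral_eq_Suc)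
  moreover have "hamming_weight (word a b c) = (\<Sum>j<q + 5. of_bool (word a b c $ j \<noteq> 0))"
    by (simp add: hamming_weight_def lessThan_def Collect_conj_eq)
  moreover have "(\<Sum>j<q + 5. of_bool (word a b c $ j \<noteq> 0)) + (\<Sum>j<q + 5. ?Z j) = (\<Sum>j<q + 5. 1)"
    unfolding sum.distrib[symmetric] by (intro sum.cong) auto
  ultimately show ?thesis by simp
qed

text \<open>Two lines through several of the last four columns would meet the conic in up to two further
  points: \<open>x = w z\<close>, which leads to \<open>x\<^sup>2 = w\<close>, and \<open>x - y = w z\<close>, which leads to \<open>x\<^sup>2 - x = w\<close> with
  discriminant \<open>1 + 4 w\<close>. Both are external because \<open>w\<close> and \<open>1 + 4 w\<close> are nonsquares.\<close>

lemma zeros_le_3: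
  assumes nz: "\<not> (a = 0 \<and> b = 0 \<and> c = 0)"
  shows "card {x :: 'a. a * x\<^sup>2 + b * x + c = 0} + of_bool (a = 0) + of_bool (b = 0)
     + of_bool (a + b = 0) + of_bool (b * w - c = 0) + of_bool (a * w + c = 0) \<le> (3::nat)"
proof (cases "a = 0")
  case a: True
  show ?thesis
  proof (cases "b = 0")
    case True
    then show ?thesis using a nz by simp
  next
    case False
    \<comment> \<open>Besides \<open>a = 0\<close> there is at most one root, and the last two
      conditions exclude each other because \<open>b * w\<close> is nonzero.\<close>
    have "{x. b * x + c = 0} \<subseteq> {- c / b}" using False by (auto simp: field_simps eq_neg_iff_add_eq_0)
    then have "card {x. b * x + c = 0} \<le> 1" using card_mono[of "{- c / b}"] by fastforce
    then show ?thesis using a False w_nz by auto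
  qed
next
  case a: False
  have N: "card {x. a * x\<^sup>2 + b * x + c = 0} \<le> 2" using a by (rule card_quadratic_roots_le)
  show ?thesis
  proof (cases "b = 0")
    case b: True
    show ?thesis
    proof (cases "c = 0")
      case True
      then have "{x. a * x\<^sup>2 + b * x + c = 0} = {0}" using a b by auto
      then show ?thesis using a b True w_nz by simp
    next
      case False
      have "a * x\<^sup>2 + b * x + c \<noteq> 0" if "c = - (a * w)" for x
      proof
        assume "a * x\<^sup>2 + b * x + c = 0"
        then have "a * (x\<^sup>2 - w) = 0" using b that by (simp add: algebra_simps)
        then show False using a nonsquare[of x] by simp
      qed
      then have "{x. a * x\<^sup>2 + b * x + c = 0} = {}" if "a * w + c = 0"
        using that by (simp add: eq_neg_iff_add_eq_0 add.commute)
      then show ?thesis using a b False N by (auto split: if_splits)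
    qed
  next
    case b: False
    have "a * x\<^sup>2 + b * x + c \<noteq> 0" if "b = - a" "c = - (a * w)" for x
    proof
      assume "a * x\<^sup>2 + b * x + c = 0"
      then have "a * (x\<^sup>2 - x - w) = 0" using that by (simp add: algebra_simps)
      then have "x\<^sup>2 - x - w = 0" using a by simp
      moreover have "(2 * x - 1)\<^sup>2 = 1 + 4 * w + 4 * (x\<^sup>2 - x - w)"
        by (simp add: power2_eq_square algebra_simps)
      ultimately have "(2 * x - 1)\<^sup>2 = 1 + 4 * w" by simp
      then show False using nonsquare_disc by blast
    qed
    then have empty: "{x. a * x\<^sup>2 + b * x + c = 0} = {}" if "a + b = 0" "a * w + c = 0"
      using that by (simp add: eq_neg_iff_add_eq_0 add.commute)
    \<comment> \<open>The columns (1, 1, 0), (0, w, -1), (w, 0, 1) are collinear: the last two add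
      up to w times the first. So two of these conditions force the third, and then there are no
      roots; otherwise at most one condition joins at most two roots.\<close>
    have imp: "b * w - c = 0 \<longleftrightarrow> a * w + c = 0" if "a + b = 0"
      using that by (auto simp: eq_neg_iff_add_eq_0[symmetric] algebra_simps)
    have imp': "a + b = 0" if "b * w - c = 0" "a * w + c = 0"
    proof -
      have "w * (a + b) = (b * w - c) + (a * w + c)" by (simp add: algebra_simps)
      then have "w * (a + b) = 0" using that by simp
      then show ?thesis using w_nz by simp
    qed
    show ?thesis using a b N empty imp imp' by (cases "a + b = 0"; cases "a * w + c = 0") auto
  qed
qed

lemma linear_code_code_w: "linear_code (q + 5) 3 (q + 2) (code_w q \<alpha> w)"
proof (rule linear_codeI[OF subspace_code_w card_code_w])
  \<comment> \<open>This word belongs to the line z = 0, on which exactly the columns (1, 0, 0), (0,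
    1, 0), (1, 1, 0) lie.\<close>
  have "hamming_weight (word 0 0 1) = q + 2" using hamming_weight_word[of 0 0 1] by simp
  then show "\<exists>c\<in>code_w q \<alpha> w. c \<noteq> 0\<^sub>v (q + 5) \<and> hamming_weight c = q + 2"
    by (intro bexI[of _ "word 0 0 1"]) (auto simp: word_eq_0 word_in_code_w)
next
  fix v assume "v \<in> code_w q \<alpha> w" "v \<noteq> 0\<^sub>v (q + 5)"
  then obtain a b c where v: "v = word a b c" "\<not> (a = 0 \<and> b = 0 \<and> c = 0)"
    using word_eq_0 by (auto simp: code_w_eq)
  then show "q + 2 \<le> hamming_weight v"
    using hamming_weight_word[of a b c] zeros_le_3[of a b c] by simp
qed

section \<open>The dual code: minimum weight and cardinality\<close>

lemma mem_dual_iff: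
  "x \<in> dual_code (q + 5) (code_w q \<alpha> w) \<longleftrightarrow> x \<in> carrier_vec (q + 5) \<and>
     x \<bullet> word 1 0 0 = 0 \<and> x \<bullet> word 0 1 0 = 0 \<and> x \<bullet> word 0 0 1 = 0"
proof -
  have "x \<bullet> word a b c = a * (x \<bullet> word 1 0 0) + b * (x \<bullet> word 0 1 0) + c * (x \<bullet> word 0 0 1)"
    if "x \<in> carrier_vec (q + 5)" for a b c
    by (subst word_linear) (use that in \<open>simp add: scalar_prod_add_distrib[where n = "q + 5"]\<close>)
  then show ?thesis by (auto simp: dual_code_def code_w_eq)
qed

text \<open>For two conic columns the last two rows form a Vandermonde system with distinct nodes;
  all other pairs are checked case by case.\<close>

lemma columns_independent_less:
  assumes ij: "i < j" "j < q + 5"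
    and e1: "s * word 1 0 0 $ i + t * word 1 0 0 $ j = 0"
    and e2: "s * word 0 1 0 $ i + t * word 0 1 0 $ j = 0"
    and e3: "s * word 0 0 1 $ i + t * word 0 0 1 $ j = 0"
  shows "s = 0 \<and> t = 0"
proof (cases "i < q \<and> j < q")
  case True
  then have "s + t = 0" "s * \<alpha> (Suc i) + t * \<alpha> (Suc j) = 0" using e2 e3 by auto
  moreover have "s * (\<alpha> (Suc i) - \<alpha> (Suc j))
      = (s * \<alpha> (Suc i) + t * \<alpha> (Suc j)) - (s + t) * \<alpha> (Suc j)"
    by (simp add: algebra_simps)
  ultimately have "s * (\<alpha> (Suc i) - \<alpha> (Suc j)) = 0" by simp
  then show ?thesis using \<open>s + t = 0\<close> True ij \<alpha>_eq_iff[of i j] by auto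
next
  case False
  have i: "i < q + 5" using ij by simp
  show ?thesis
    by (insert False ij(1) e1 e2 e3 w_nz,
        rule position_cases[OF i]; rule position_cases[OF ij(2)]; force)
qed

lemma columns_independent:
  assumes "i \<noteq> j" "i < q + 5" "j < q + 5"
    and "s * word 1 0 0 $ i + t * word 1 0 0 $ j = 0"
    and "s * word 0 1 0 $ i + t * word 0 1 0 $ j = 0"
    and "s * word 0 0 1 $ i + t * word 0 0 1 $ j = 0"
  shows "s = 0 \<and> t = 0"
  using assms columns_independent_less[of i j s t] columns_independent_less[of j i t s]
  by (cases "i < j") (simp_all add: add.commute)

text \<open>A nonzero dual word of smaller weight would be a linear relation between two
  columns.\<close>

lemma dual_weight_ge_3:
  assumes x: "x \<in> dual_code (q + 5) (code_w q \<alpha> w)" and nz: "x \<noteq> 0\<^sub>v (q + 5)"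
  shows "3 \<le> hamming_weight x"
proof (rule ccontr)
  define S where "S = {l. l < q + 5 \<and> x $ l \<noteq> 0}"
  have xc: "x \<in> carrier_vec (q + 5)"
    and x0: "x \<bullet> word 1 0 0 = 0" "x \<bullet> word 0 1 0 = 0" "x \<bullet> word 0 0 1 = 0"
    using x by (simp_all add: mem_dual_iff)
  assume "\<not> 3 \<le> hamming_weight x"
  moreover have "hamming_weight x = card S"
    unfolding hamming_weight_def S_def carrier_vecD[OF xc] ..
  ultimately have "card S \<le> 2" by simp
  have "S \<subseteq> {..<q + 5}" by (auto simp: S_def)
  have "S \<noteq> {}"
  proof
    assume "S = {}"
    then have "x $ l = 0" if "l < q + 5" for l using that unfolding S_def by blast
    then have "x = 0\<^sub>v (q + 5)" using xc by (intro eq_vecI) simp_all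
    then show False using nz by contradiction
  qed
  then obtain i where i: "i \<in> S" by blast
  have "finite S" using \<open>S \<subseteq> {..<q + 5}\<close> finite_subset by blast
  then have "card (S - {i}) \<le> 1" using i \<open>card S \<le> 2\<close> by simp
  then have "S - {i} = {} \<or> (\<exists>j. S - {i} = {j})"
    using \<open>finite S\<close> by (auto simp: le_Suc_eq card_1_singleton_iff)
  \<comment> \<open>If the support is only \<open>{i}\<close>, any other position can serve as the
    second one.\<close>
  moreover have "\<exists>j<q + 5. j \<noteq> i" by (rule exI[of _ "if i = 0 then 1 else 0"]) simp
  ultimately obtain j where j: "j \<noteq> i" "j < q + 5" "S \<subseteq> {i, j}"
    using \<open>S \<subseteq> {..<q + 5}\<close> by blast
  have ij: "i < q + 5" "i \<noteq> j" using i j \<open>S \<subseteq> {..<q + 5}\<close> by blast+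
  have prod: "x \<bullet> y = x $ i * y $ i + x $ j * y $ j" if "y \<in> carrier_vec (q + 5)" for y
    using scalar_prod_two_entries[OF xc that j(3)[unfolded S_def] ij(1) j(2) ij(2)] .
  have "x $ i = 0 \<and> x $ j = 0"
    by (rule columns_independent[OF ij(2,1) j(2)]) (simp_all only: prod[symmetric] word_carrier x0)
  then show False using i unfolding S_def by blast
qed

text \<open>The relation \<open>rel\<close> expresses that three columns are linearly dependent; its
  coefficients, padded with zeros, form the dual word.\<close>

lemma dual_three_term_word:
  assumes "i < q + 5" "j < q + 5" "k < q + 5" "distinct [i, j, k]"
    and "s \<noteq> 0" "t \<noteq> 0" "u \<noteq> 0"
    and rel: "\<And>a b c. s * word a b c $ i + t * word a b c $ j + u * word a b c $ k = 0"
  shows "\<exists>x\<in>dual_code (q + 5) (code_w q \<alpha> w).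
    hamming_weight x = 3 \<and> x $ i \<noteq> 0 \<and> x $ j \<noteq> 0 \<and> x $ k \<noteq> 0"
proof -
  define x where "x = vec (q + 5) (\<lambda>l. if l = i then s else if l = j then t
    else if l = k then u else 0)"
  have x: "x \<in> carrier_vec (q + 5)" "x $ i = s" "x $ j = t" "x $ k = u"
    using assms by (auto simp: x_def)
  have "x \<bullet> word a b c = 0" for a b c
  proof -
    have "x \<bullet> word a b c = (\<Sum>l<q + 5. x $ l * word a b c $ l)"
      by (simp add: scalar_prod_def atLeast0LessThan)
    also have "\<dots> = (\<Sum>l\<in>{i, j, k}. x $ l * word a b c $ l)"
      using assms by (intro sum.mono_neutral_right) (auto simp: x_def)
    also have "\<dots> = 0" using assms x rel[of a b c] by (simp add: add.assoc)
    finally show ?thesis .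
  qed
  moreover have "{l. l < q + 5 \<and> x $ l \<noteq> 0} = {i, j, k}"
    using assms by (auto simp: x_def split: if_splits)
  then have "hamming_weight x = 3"
    using x assms by (simp add: hamming_weight_def)
  ultimately show ?thesis using x assms by (intro bexI[of _ x]) (auto simp: mem_dual_iff)
qed

lemma dual_weight_3_at:
  assumes "i < q + 5"
  shows "\<exists>x\<in>dual_code (q + 5) (code_w q \<alpha> w). hamming_weight x = 3 \<and> x $ i \<noteq> 0"
proof -
  \<comment> \<open>(1, 0, 0) + (0, 1, 0) = (1, 1, 0), on the line z = 0.\<close>
  have at_infinity: "\<exists>x\<in>dual_code (q + 5) (code_w q \<alpha> w). hamming_weight x = 3 \<and>
      x $ q \<noteq> 0 \<and> x $ Suc q \<noteq> 0 \<and> x $ Suc (Suc q) \<noteq> 0"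
    by (rule dual_three_term_word[of _ _ _ 1 1 "- 1"]) auto
  \<comment> \<open>(0, 0, 1) + (0, w, -1) = w (0, 1, 0), on the line x = 0.\<close>
  have at_0: "\<exists>x\<in>dual_code (q + 5) (code_w q \<alpha> w). hamming_weight x = 3 \<and>
      x $ (q - 1) \<noteq> 0 \<and> x $ (q + 3) \<noteq> 0 \<and> x $ Suc q \<noteq> 0"
    by (rule dual_three_term_word[of _ _ _ 1 1 "- w"])
       (use w_nz q_gt_1 in auto)
  \<comment> \<open>(0, w, -1) + (w, 0, 1) = w (1, 1, 0), on the line x - y - w z = 0.\<close>
  have at_extra: "\<exists>x\<in>dual_code (q + 5) (code_w q \<alpha> w). hamming_weight x = 3 \<and>
      x $ (q + 3) \<noteq> 0 \<and> x $ (q + 4) \<noteq> 0 \<and> x $ Suc (Suc q) \<noteq> 0"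
    by (rule dual_three_term_word[of _ _ _ 1 1 "- w"])
       (use w_nz in \<open>auto simp: algebra_simps\<close>)
  show ?thesis using assms
  proof (cases rule: position_cases)
    case 1
    show ?thesis
    proof (cases "\<alpha> (Suc i) = 0")
      case True
      then have "i = q - 1" using 1 q_gt_1 \<alpha>_q \<alpha>_eq_iff[of i "q - 1"] by auto
      then show ?thesis using at_0 by blast
    next
      case False
      \<comment> \<open>The conic columns of a field element and of its negative differ by a
        multiple of (0, 1, 0); they are distinct since 2 is nonzero.\<close>
      obtain j where j: "j < q" "\<alpha> (Suc j) = - \<alpha> (Suc i)" by (rule \<alpha>_surj)
      have "2 * \<alpha> (Suc i) \<noteq> 0" using False two_nz by simp
      then have "i \<noteq> j" using j(2) by (metis eq_neg_iff_add_eq_0 mult_2)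
      have "\<exists>x\<in>dual_code (q + 5) (code_w q \<alpha> w). hamming_weight x = 3 \<and>
          x $ i \<noteq> 0 \<and> x $ j \<noteq> 0 \<and> x $ Suc q \<noteq> 0"
        by (rule dual_three_term_word[of _ _ _ 1 "- 1" "- (2 * \<alpha> (Suc i))"])
           (use 1 j \<open>i \<noteq> j\<close> \<open>2 * \<alpha> (Suc i) \<noteq> 0\<close> in \<open>auto simp: algebra_simps\<close>)
      then show ?thesis by blast
    qed
  qed (use at_infinity at_0 at_extra in blast)+
qed

text \<open>The columns at \<open>q\<close>, \<open>q + 1\<close> and \<open>q - 1\<close> are the three unit vectors, so a dual word is
  determined by its other entries, which are arbitrary.\<close>

lemma card_dual: "card (dual_code (q + 5) (code_w q \<alpha> w)) = CARD('a) ^ (q + 2)"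
proof -
  let ?D = "dual_code (q + 5) (code_w q \<alpha> w)"
  let ?V = "carrier_vec (q + 5) :: 'a vec set"
  \<comment> \<open>\<open>syn\<close> is the syndrome, with the dual code as its kernel;
    \<open>e\<close> is a right inverse of \<open>syn\<close> supported on the unit-vector
    columns.\<close>
  define e where "e = (\<lambda>(s, t, u). vec (q + 5) (\<lambda>l. if l = q then s else if l = Suc q then t
    else if l = q - 1 then u else (0::'a)))"
  define syn where "syn = (\<lambda>x. (x \<bullet> word 1 0 0, x \<bullet> word 0 1 0, x \<bullet> word 0 0 1))"
  have e_carrier: "e p \<in> ?V" for p by (cases p) (simp add: e_def)
  have dim_e: "dim_vec (e p) = q + 5" for p using e_carrier carrier_vecD by blast
  have sub_add: "y - e p + e p = y" and add_sub: "y + e p - e p = y" if "y \<in> ?V" for y p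
    using that by (auto simp: dim_e intro!: eq_vecI)
  have syn_add: "syn (x + y) = syn x + syn y" if "x \<in> ?V" "y \<in> ?V" for x y
    using that by (simp add: syn_def add_scalar_prod_distrib[where n = "q + 5"])
  have syn_e: "syn (e p) = p" for p
  proof -
    obtain s t u where p: "p = (s, t, u)" by (cases p)
    have "e p \<bullet> y = s * y $ q + t * y $ Suc q + u * y $ (q - 1)" if "y \<in> ?V" for y
    proof -
      have "e p \<bullet> y = (\<Sum>l<q + 5. e p $ l * y $ l)"
        using that by (simp add: scalar_prod_def atLeast0LessThan)
      also have "\<dots> = (\<Sum>l\<in>{q, Suc q, q - 1}. e p $ l * y $ l)"
        by (intro sum.mono_neutral_right) (auto simp: e_def p)
      also have "\<dots> = s * y $ q + t * y $ Suc q + u * y $ (q - 1)"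
        using q_gt_1 by (auto simp: e_def p add.assoc)
      finally show ?thesis .
    qed
    then show ?thesis by (simp add: syn_def p)
  qed
  have D: "x \<in> ?D \<longleftrightarrow> x \<in> ?V \<and> syn x = 0" for x
    by (simp add: mem_dual_iff syn_def zero_prod_def)
  \<comment> \<open>Every vector splits uniquely into a dual word and the \<open>e\<close>-image of
    its syndrome.\<close>
  have "bij_betw (\<lambda>(x, p). x + e p) (?D \<times> UNIV) ?V"
  proof (rule bij_betw_byWitness[where f' = "\<lambda>y. (y - e (syn y), syn y)"])
    have diff: "y - e (syn y) \<in> ?D" if "y \<in> ?V" for y
    proof -
      have *: "y - e (syn y) \<in> ?V" using that e_carrier by (rule minus_carrier_vec)
      have "syn (y - e (syn y)) + syn y = syn y"
        using syn_add[OF * e_carrier, of "syn y"] sub_add[OF that] syn_e by metis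
      then have "syn (y - e (syn y)) = 0" by (rule add_cancel_left_left[THEN iffD1])
      then show ?thesis using * by (simp only: D)
    qed
    show "\<forall>a\<in>?D \<times> UNIV. (\<lambda>y. (y - e (syn y), syn y)) ((\<lambda>(x, p). x + e p) a) = a"
      by (auto simp: D syn_add e_carrier syn_e add_sub)
    show "\<forall>y\<in>?V. (\<lambda>(x, p). x + e p) (y - e (syn y), syn y) = y"
      by (simp add: sub_add)
    show "(\<lambda>(x, p). x + e p) ` (?D \<times> UNIV) \<subseteq> ?V"
      using e_carrier by (auto simp: D)
    show "(\<lambda>y. (y - e (syn y), syn y)) ` ?V \<subseteq> ?D \<times> UNIV"
      using diff by auto
  qed
  then have "card (?D \<times> (UNIV :: ('a \<times> 'a \<times> 'a) set)) = card ?V" by (rule bij_betw_same_card)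
  then have "card ?D * CARD('a) ^ 3 = CARD('a) ^ (q + 5)"
    by (simp add: card_cartesian_product card_prod card_carrier_vec power3_eq_cube)
  also have "\<dots> = CARD('a) ^ (q + 2) * CARD('a) ^ 3"
    by (subst power_add[symmetric]) (simp add: numeral_eq_Suc)
  finally show ?thesis using card_field q_gt_1 by simp
qed

lemma linear_code_dual: "linear_code (q + 5) (q + 2) 3 (dual_code (q + 5) (code_w q \<alpha> w))"
proof (rule linear_codeI[OF subspace_dual_code[OF code_w_carrier] card_dual])
  obtain x where x: "x \<in> dual_code (q + 5) (code_w q \<alpha> w)" "hamming_weight x = 3" "x $ 0 \<noteq> 0"
    using dual_weight_3_at[of 0] by auto
  then have "x \<noteq> 0\<^sub>v (q + 5)" by auto
  then show "\<exists>c\<in>dual_code (q + 5) (code_w q \<alpha> w). c \<noteq> 0\<^sub>v (q + 5) \<and> hamming_weight c = 3"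
    using x by blast
qed (rule dual_weight_ge_3)

section \<open>Locality and optimality\<close>

lemma locality_code_w: "has_locality (q + 5) 2 (code_w q \<alpha> w)"
proof (rule has_locality_if_check_words[OF code_w_carrier])
  fix i assume "i < q + 5"
  then obtain x where "x \<in> dual_code (q + 5) (code_w q \<alpha> w)" "hamming_weight x = 3" "x $ i \<noteq> 0"
    using dual_weight_3_at by blast
  then show "\<exists>x\<in>carrier_vec (q + 5). (\<forall>c\<in>code_w q \<alpha> w. x \<bullet> c = 0) \<and> x $ i \<noteq> 0 \<and>
      hamming_weight x \<le> 2 + 1"
    by (auto simp: dual_code_def)
qed

text \<open>Each of the trisecant lines \<open>z = 0\<close>, \<open>x = 0\<close> and \<open>x - y - w z = 0\<close> gives a check word of
  weight \<open>q + 2\<close>, and no position lies on all three.\<close>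

lemma locality_dual: "has_locality (q + 5) (q + 1) (dual_code (q + 5) (code_w q \<alpha> w))"
proof (rule has_locality_if_check_words)
  fix i assume i: "i < q + 5"
  have wt: "hamming_weight (word 0 0 1) = q + 2" "hamming_weight (word 1 0 0) = q + 2"
    using hamming_weight_word[of 0 0 1] hamming_weight_word[of 1 0 0] w_nz by simp_all
  \<comment> \<open>Three of the last five entries vanish; roots on the conic could only lower the
    weight, so the bound holds without counting them.\<close>
  have wt': "hamming_weight (word 1 (- 1) (- w)) \<le> q + 2"
    using hamming_weight_word[of 1 "- 1" "- w"] by simp
  have "\<exists>a b c. word a b c $ i \<noteq> 0 \<and> hamming_weight (word a b c) \<le> q + 2"
    using i
  proof (cases rule: position_cases)
    case 1 then show ?thesis using wt by (intro exI[of _ 0] exI[of _ 1]) simp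
  next
    case 2 then show ?thesis using wt by (intro exI[of _ 1] exI[of _ 0]) simp
  next
    case 3 then show ?thesis using wt'
      by (intro exI[of _ 1] exI[of _ "- 1"] exI[of _ "- w"]) simp
  next
    case 4 then show ?thesis using wt by (intro exI[of _ 1] exI[of _ 0]) simp
  next
    case 5 then show ?thesis using wt by (intro exI[of _ 0] exI[of _ 1]) simp
  next
    case 6 then show ?thesis using wt by (intro exI[of _ 0] exI[of _ 1]) simp
  qed
  then obtain a b c where abc: "word a b c $ i \<noteq> 0" "hamming_weight (word a b c) \<le> q + 2"
    by blast
  have "word a b c \<bullet> x = 0" if "x \<in> dual_code (q + 5) (code_w q \<alpha> w)" for x
  proof -
    have "x \<in> carrier_vec (q + 5)" "x \<bullet> word a b c = 0"
      using that by (auto simp: dual_code_def code_w_eq)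
    then show ?thesis by (simp add: comm_scalar_prod[OF word_carrier])
  qed
  then show "\<exists>x\<in>carrier_vec (q + 5). (\<forall>c\<in>dual_code (q + 5) (code_w q \<alpha> w). x \<bullet> c = 0) \<and>
      x $ i \<noteq> 0 \<and> hamming_weight x \<le> (q + 1) + 1"
    using abc by (intro bexI[of _ "word a b c"]) auto
qed (auto simp: dual_code_def)

text \<open>The defects are (q + 5) - 3 + 1 - (q + 2) = 1 and (q + 5) - (q + 2) + 1 - 3 = 1.\<close>

lemma NMDS_code_w: "NMDS (q + 5) (code_w q \<alpha> w)"
  unfolding NMDS_def
  using linear_code_code_w linear_code_dual by (force simp: singleton_defect_def)

lemma LRC_code_w: "LRC (q + 5) 3 2 (code_w q \<alpha> w)"
  using code_w_carrier card_code_w locality_code_w by (simp add: LRC_def)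

lemma LRC_dual: "LRC (q + 5) (q + 2) (q + 1) (dual_code (q + 5) (code_w q \<alpha> w))"
  using card_dual locality_dual by (auto simp: LRC_def dual_code_def)

lemma d_optimal_code_w: "d_optimal (q + 5) 3 2 (code_w q \<alpha> w)"
proof -
  have "\<lceil>real 3 / real 2\<rceil> = 2" by (simp add: ceiling_eq_iff)
  then show ?thesis
    using LRC_code_w linear_code_has_min_dist[OF linear_code_code_w]
    by (auto simp: d_optimal_def intro!: exI[of _ "q + 2"])
qed

text \<open>As k = r + 1 with r > 1, k / r lies strictly between 1 and 2, so the bound is (q + 5) -
  (q + 2) - 2 + 2 = 3.\<close>

lemma d_optimal_dual: "d_optimal (q + 5) (q + 2) (q + 1) (dual_code (q + 5) (code_w q \<alpha> w))"
proof -
  have "\<lceil>real (q + 2) / real (q + 1)\<rceil> = 2" by (simp add: ceiling_eq_iff field_simps)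
  then show ?thesis
    using LRC_dual linear_code_has_min_dist[OF linear_code_dual] unfolding d_optimal_def
    by (intro conjI exI[of _ 3]) simp_all
qed

lemma k_optimal_code_w: "k_optimal (q + 5) 3 2 (code_w q \<alpha> w)"
  by (rule k_optimalI[OF LRC_code_w linear_code_has_min_dist[OF linear_code_code_w]]) simp_all

lemma k_optimal_dual: "k_optimal (q + 5) (q + 2) (q + 1) (dual_code (q + 5) (code_w q \<alpha> w))"
  by (rule k_optimalI[OF LRC_dual linear_code_has_min_dist[OF linear_code_dual]]) simp_all

end

theorem theorem4p6:
  fixes p m q :: nat
    and w :: "'a::{field,finite}"
    and \<alpha> :: "nat \<Rightarrow> 'a"
  assumes "prime p" and "odd p" and "m > 0" and "q = p ^ m" and "CARD('a) = q"
    and "quad_char w = - 1" and "quad_char (1 + 4 * w) = - 1"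
    and "bij_betw \<alpha> {1..q} UNIV" and "\<alpha> q = 0"
  shows "linear_code (q + 5) 3 (q + 2) (code_w q \<alpha> w) \<and> NMDS (q + 5) (code_w q \<alpha> w) \<and>
    has_locality (q + 5) 2 (code_w q \<alpha> w) \<and>
    has_locality (q + 5) (q + 1) (dual_code (q + 5) (code_w q \<alpha> w)) \<and>
    d_optimal (q + 5) 3 2 (code_w q \<alpha> w) \<and>
    k_optimal (q + 5) 3 2 (code_w q \<alpha> w) \<and>
    d_optimal (q + 5) (q + 2) (q + 1) (dual_code (q + 5) (code_w q \<alpha> w)) \<and>
    k_optimal (q + 5) (q + 2) (q + 1) (dual_code (q + 5) (code_w q \<alpha> w))"
proof -
  have "nmds_parameters q \<alpha> w"
  proof
    \<comment> \<open>The character takes the value - 1 only in the branch without a square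
      root.\<close>
    show "y\<^sup>2 \<noteq> w" for y using assms(6) by (auto simp: quad_char_def split: if_splits)
    show "y\<^sup>2 \<noteq> 1 + 4 * w" for y using assms(7) by (metis quad_char_def zero_neq_neg_one one_neq_neg_one)
  qed (use assms in auto)
  then interpret nmds_parameters q \<alpha> w .
  show ?thesis
    using linear_code_code_w NMDS_code_w locality_code_w locality_dual d_optimal_code_w
      k_optimal_code_w d_optimal_dual k_optimal_dual by blast
qed

end
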